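(* Let $\{x^k\}_{k\ge0}$ be generated by the algorithm LBTFWGSC (described in the context) applied to $\min_{x\in\mathcal X}f(x)$, under the standing assumptions listed in the context. For $x^0\in\mathcal X\cap\operatorname{dom}f$ and $\varepsilon>0$, put $h_k=f(x^k)-f^*$ and $N_\varepsilon(x^0)=\inf\{k\ge0:h_k\le\varepsilon\}$. Then, for all $\varepsilon>0$, $$N_{\varepsilon}(x^{0})\leq \frac{\ln\left(\bar{L}\operatorname{diam}(\mathcal X)^{2}/h_{0}\right)}{\ln(1/2)}+\frac{2\bar{L}\operatorname{diam}(\mathcal X)^{2}}{\varepsilon},$$ where $\bar L=\max\{\gamma_uL_{\nabla f},\mathcal L_{-1}\}$.
   Context: **Generalized self-concordance (GSC).** For $\nu\in[2,3]$ and $M_f\ge0$, $\mathcal F_{M_f,\nu}$ is the class of closed (lower semicontinuous) convex functions $f:\mathbb R^n\to(-\infty,+\infty]$ with $\operatorname{dom}f=\{f<\infty\}$ open and nonempty, $f$ three times continuously differentiable on $\operatorname{dom}f$, and $|\langle D^3f(x)[v]u,u\rangle|\le M_f\|u\|_x^2\|v\|_x^{\nu-2}\|v\|_2^{3-\nu}$ for all $x\in\operatorname{dom}f$, $u,v\in\mathbb R^n$, where $\|u\|_x=\sqrt{\langle\nabla^2f(x)u,u\rangle}$. **Standing assumptions.** $f\in\mathcal F_{M_f,\nu}$ with $\nu\in[2,3]$; $\mathcal X\subset\mathbb R^n$ is convex and compact, and linear functions can be minimized over it efficiently and accurately; $\min_{x\in\mathcal X}f(x)$ has a solution $x^*$,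 $f^*=f(x^* )$; $\nabla^2f$ is continuous and positive definite on $\mathcal X\cap\operatorname{dom}f$; given a point $x$, it is easy to decide whether $x\in\operatorname{dom}f$ (a domain oracle). **Frank-Wolfe quantities** for $x\in\mathcal X\cap\operatorname{dom}f$: $s(x)\in\arg\min_{d\in\mathcal X}\langle\nabla f(x),d\rangle$ (a fixed selection), $\mathsf{Gap}(x)=\max_{s\in\mathcal X}\langle\nabla f(x),x-s\rangle$, $v_{FW}(x)=s(x)-x$. **Quadratic model.** $Q_L(x,t,L)=f(x)-t\,\mathsf{Gap}(x)+\frac{t^2L}{2}\|v_{FW}(x)\|_2^2$. **Algorithm LBTFWGSC.** Inputs: $x^0\in\mathcal X\cap\operatorname{dom}f$, an initial Lipschitz estimate $\mathcal L_{-1}>0$, fixed scaling parameters $\gamma_u>1$ and $\gamma_d<1$, and an error tolerance $\varepsilon>0$. For $k=0,1,\dots$: if $\mathsf{Gap}(x^k)>\varepsilon$, put $v^k=v_{FW}(x^k)$ and run the backtracking: choose $\tilde L\in[\gamma_d\mathcal L_{k-1},\mathcal L_{k-1}]$ and set $\alpha=\min\{1,\frac{\mathsf{Gap}(x^k)}{\tilde L\|v^k\|_2^2}\}$; while $x^k+\alpha v^k\notin\operatorname{dom}f$ or $f(x^k+\alpha v^k)>Q_L(x^k,\alpha,\tilde L)$, replace $\tilde L$ by $\gamma_u\tilde L$ and recompute $\alpha=\min\{1,\frac{\mathsf{Gap}(x^k)}{\tilde L\|v^k\|_2^2}\}$. On exit set $\alpha_k=\alpha$, $\mathcal L_k=\tilde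 L$, $x^{k+1}=x^k+\alpha_kv^k$. **Constants.** $\mathcal S(x^0)=\{x\in\mathcal X\cap\operatorname{dom}f: f(x)\le f(x^0)\}$ (compact) and $L_{\nabla f}=\max_{x\in\mathcal S(x^0)}\lambda_{\max}(\nabla^2f(x))$.
   Formalization: The printed right-hand side can be negative for large ε although N_ε is at least 0, so the bound is stated with the maximum of 0 and that expression; if h_0 = 0 the logarithmic term is read as 0. Also γ_d > 0 is made explicit so that the step sizes are defined. *)

theory Defs
  imports "HOL-Analysis.Analysis" "HOL-Library.Extended_Nat"
begin

section \<open>Extended-valued functions and their derivatives\<close>

definition effdom :: "('a \<Rightarrow> ereal) \<Rightarrow> 'a set" where
  "effdom f = {x. f x < \<infinity>}"

definition rval :: "('a \<Rightarrow> ereal) \<Rightarrow> 'a \<Rightarrow> real" where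
  "rval f x = real_of_ereal (f x)"

definition lsc :: "('a::topological_space \<Rightarrow> ereal) \<Rightarrow> bool" where
  "lsc f \<longleftrightarrow> (\<forall>x. f x \<le> Liminf (at x) f)"

text \<open>The derivatives below are used only at points of the open set \<open>effdom f\<close>, where
  membership in the class \<open>gsc\<close> guarantees that they exist.\<close>

definition grad :: "(real^'n \<Rightarrow> ereal) \<Rightarrow> real^'n \<Rightarrow> real^'n" where
  "grad f x = (THE g. GDERIV (rval f) x :> g)"

definition hess :: "(real^'n \<Rightarrow> ereal) \<Rightarrow> real^'n \<Rightarrow> real^'n^'n" where
  "hess f x = matrix (frechet_derivative (grad f) (at x))"

text \<open>\<open>D3 f x v\<close> is the matrix of the bilinear form $D^3f(x)[v]$, i.e. the derivative of the
  Hessian at \<open>x\<close> in the direction \<open>v\<close>.\<close>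

definition D3 :: "(real^'n \<Rightarrow> ereal) \<Rightarrow> real^'n \<Rightarrow> real^'n \<Rightarrow> real^'n^'n" where
  "D3 f x v = frechet_derivative (hess f) (at x) v"

definition C3_on :: "(real^'n) set \<Rightarrow> (real^'n \<Rightarrow> ereal) \<Rightarrow> bool" where
  "C3_on U f \<longleftrightarrow>
     (\<forall>x\<in>U. rval f differentiable (at x)) \<and>
     (\<forall>x\<in>U. grad f differentiable (at x)) \<and>
     (\<forall>x\<in>U. hess f differentiable (at x)) \<and>
     (\<forall>v. continuous_on U (\<lambda>x. D3 f x v))"

section \<open>Generalized self-concordance\<close>

definition loc_norm :: "(real^'n \<Rightarrow> ereal) \<Rightarrow> real^'n \<Rightarrow> real^'n \<Rightarrow> real" where
  "loc_norm f x u = sqrt ((hess f x *v u) \<bullet> u)"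

text \<open>In the defining inequality the exponents $\nu - 2$ and $3 - \nu$ may vanish, and $a^0 = 1$
  is meant also for $a = 0$, whereas \<open>0 powr 0 = 0\<close>.\<close>

definition rpow :: "real \<Rightarrow> real \<Rightarrow> real" where
  "rpow a b = (if b = 0 then 1 else a powr b)"

definition gsc :: "real \<Rightarrow> real \<Rightarrow> (real^'n \<Rightarrow> ereal) \<Rightarrow> bool" where
  "gsc M \<nu> f \<longleftrightarrow>
     (\<forall>x. f x \<noteq> -\<infinity>) \<and> lsc f \<and> convex_on (effdom f) (rval f) \<and>
     open (effdom f) \<and> effdom f \<noteq> {} \<and> C3_on (effdom f) f \<and>
     (\<forall>x\<in>effdom f. \<forall>u v.
        \<bar>(D3 f x v *v u) \<bullet> u\<bar>
          \<le> M * (loc_norm f x u)^2 * rpow (loc_norm f x v) (\<nu> - 2) * rpow (norm v) (3 - \<nu>))"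

section \<open>Spectral quantities\<close>

definition pos_def :: "real^'n^'n \<Rightarrow> bool" where
  "pos_def A \<longleftrightarrow> transpose A = A \<and> (\<forall>u. u \<noteq> 0 \<longrightarrow> (A *v u) \<bullet> u > 0)"

text \<open>For a symmetric matrix the set of real eigenvalues is finite and nonempty, so that the
  supremum is its maximum.\<close>

definition lambda_max :: "real^'n^'n \<Rightarrow> real" where
  "lambda_max A = Sup {c. \<exists>v. v \<noteq> 0 \<and> A *v v = c *\<^sub>R v}"

definition level_set :: "(real^'n \<Rightarrow> ereal) \<Rightarrow> (real^'n) set \<Rightarrow> real^'n \<Rightarrow> (real^'n) set" where
  "level_set f X x0 = {x \<in> X \<inter> effdom f. f x \<le> f x0}"

text \<open>Under the standing assumptions of the theorem the level set is compact and the Hessian is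
  continuous on it, so that this supremum is a maximum as well.\<close>

definition L_grad :: "(real^'n \<Rightarrow> ereal) \<Rightarrow> (real^'n) set \<Rightarrow> real^'n \<Rightarrow> real" where
  "L_grad f X x0 = (SUP x\<in>level_set f X x0. lambda_max (hess f x))"

section \<open>The Frank-Wolfe method with backtracking over the Lipschitz parameter\<close>

definition lmo :: "(real^'n \<Rightarrow> ereal) \<Rightarrow> (real^'n) set \<Rightarrow> (real^'n \<Rightarrow> real^'n) \<Rightarrow> bool" where
  "lmo f X s \<longleftrightarrow>
     (\<forall>x\<in>X \<inter> effdom f. is_arg_min (\<lambda>d. grad f x \<bullet> d) (\<lambda>d. d \<in> X) (s x))"

definition Gap :: "(real^'n \<Rightarrow> ereal) \<Rightarrow> (real^'n) set \<Rightarrow> real^'n \<Rightarrow> real" where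
  "Gap f X x = (SUP s\<in>X. grad f x \<bullet> (x - s))"

definition v_FW :: "(real^'n \<Rightarrow> real^'n) \<Rightarrow> real^'n \<Rightarrow> real^'n" where
  "v_FW s x = s x - x"

definition Q_L ::
  "(real^'n \<Rightarrow> ereal) \<Rightarrow> (real^'n) set \<Rightarrow> (real^'n \<Rightarrow> real^'n) \<Rightarrow> real^'n \<Rightarrow> real \<Rightarrow> real \<Rightarrow> real"
  where
  "Q_L f X s x t L = rval f x - t * Gap f X x + t^2 * L / 2 * (norm (v_FW s x))^2"

definition step_size ::
  "(real^'n \<Rightarrow> ereal) \<Rightarrow> (real^'n) set \<Rightarrow> (real^'n \<Rightarrow> real^'n) \<Rightarrow> real^'n \<Rightarrow> real \<Rightarrow> real" where
  "step_size f X s x L = min 1 (Gap f X x / (L * (norm (v_FW s x))^2))"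

text \<open>The negation of the loop condition of the backtracking procedure.\<close>

definition accepted ::
  "(real^'n \<Rightarrow> ereal) \<Rightarrow> (real^'n) set \<Rightarrow> (real^'n \<Rightarrow> real^'n) \<Rightarrow> real^'n \<Rightarrow> real \<Rightarrow> bool" where
  "accepted f X s x L \<longleftrightarrow>
     (let \<alpha> = step_size f X s x L; y = x + \<alpha> *\<^sub>R v_FW s x
      in y \<in> effdom f \<and> rval f y \<le> Q_L f X s x \<alpha> L)"

text \<open>\<open>L\<close> is a possible exit value of the backtracking started at \<open>x\<close> with the previous
  estimate \<open>Lprev\<close>: the initial trial value is \<open>L0\<close> and \<open>i\<close> is the number of executions of the
  loop body.\<close>

definition backtrack ::
  "(real^'n \<Rightarrow> ereal) \<Rightarrow> (real^'n) set \<Rightarrow> (real^'n \<Rightarrow> real^'n) \<Rightarrow> real \<Rightarrow> real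
     \<Rightarrow> real^'n \<Rightarrow> real \<Rightarrow> real \<Rightarrow> bool" where
  "backtrack f X s \<gamma>u \<gamma>d x Lprev L \<longleftrightarrow>
     (\<exists>L0\<in>{\<gamma>d * Lprev..Lprev}. \<exists>i::nat.
        L = \<gamma>u^i * L0 \<and> accepted f X s x L \<and> (\<forall>j<i. \<not> accepted f X s x (\<gamma>u^j * L0)))"

text \<open>A complete run, with iterates \<open>x k\<close> for \<open>k \<le> T\<close>: either \<open>T = \<infinity>\<close>, or the method stops at
  \<open>x T\<close> because the gap does not exceed the tolerance. The estimates are shifted by one index:
  \<open>est k\<close> is $\mathcal L_{k-1}$, the estimate available at the beginning of iteration \<open>k\<close>, so
  \<open>est 0\<close> is the input $\mathcal L_{-1}$. Values of \<open>x\<close> and \<open>est\<close> beyond \<open>T\<close> are irrelevant.\<close>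

definition LBTFWGSC_run ::
  "(real^'n \<Rightarrow> ereal) \<Rightarrow> (real^'n) set \<Rightarrow> (real^'n \<Rightarrow> real^'n) \<Rightarrow> real \<Rightarrow> real \<Rightarrow> real
     \<Rightarrow> (nat \<Rightarrow> real^'n) \<Rightarrow> (nat \<Rightarrow> real) \<Rightarrow> enat \<Rightarrow> bool" where
  "LBTFWGSC_run f X s \<gamma>u \<gamma>d \<epsilon> x est T \<longleftrightarrow>
     (\<forall>k. enat k < T \<longrightarrow>
        Gap f X (x k) > \<epsilon> \<and>
        backtrack f X s \<gamma>u \<gamma>d (x k) (est k) (est (Suc k)) \<and>
        x (Suc k) = x k + step_size f X s (x k) (est (Suc k)) *\<^sub>R v_FW s (x k)) \<and>
     (\<forall>k. T = enat k \<longrightarrow> Gap f X (x k) \<le> \<epsilon>)"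

text \<open>The value is \<open>\<infinity>\<close> if no iterate of the run has accuracy \<open>\<epsilon>\<close>. The
  theorem bounds it by the nonnegative part of the usual expression: the latter can be negative for
  $\epsilon \ge h_0$ (the logarithmic term is negative if $h_0 < \bar L \mathrm{diam}(X)^2$), where
  \<open>N_eps = 0\<close>.\<close>

definition N_eps ::
  "(real^'n \<Rightarrow> ereal) \<Rightarrow> real \<Rightarrow> real \<Rightarrow> (nat \<Rightarrow> real^'n) \<Rightarrow> enat \<Rightarrow> enat" where
  "N_eps f fstar \<epsilon> x T = Inf {enat k | k. enat k \<le> T \<and> rval f (x k) - fstar \<le> \<epsilon>}"

end

theory Submission
  imports Defs
begin

text \<open>
  Write $h_k = f(x^k) - f^*$ and $C = \bar L\, \mathrm{diam}(X)^2$. Three facts combine.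

  The estimates never exceed $\bar L$. On the initial level set all Hessians are bounded by
  $L_{\nabla f}$, so a trial value $L \ge L_{\nabla f}$ is always accepted
  (\<open>accepted_if_L_grad_le\<close>). The delicate point is that the curvature bound is only known
  inside the level set, while the trial point might leave it, or even leave the domain of $f$.
  It does not: as long as the segment is in the level set, the curvature bound forces the slope of
  $f$ along the segment to stay negative before the prescribed step size is reached, so the first
  exit cannot happen earlier. Hence a rejected value is below $L_{\nabla f}$, and its successor
  is below $\gamma_u L_{\nabla f}$.

  The step size minimizes the accepted quadratic model over $[0,1]$. As $h_k \le \mathsf{Gap}(x^k)$
  by convexity, any $\beta \in [0,1]$ may be inserted into the model, which gives
  $h_{k+1} \le (1-\beta) h_k + \beta^2 C / 2$ (\<open>run_step\<close>).

  This recursion is solved by the reciprocals $C / h_k$ (\<open>frank_wolfe_recursion_count\<close>).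
  If $h_0 \ge C$, then $\beta = 1$ gives $h_1 \le C/2$ in a single step; once $h_k < C$, the choice
  $\beta = h_k / C$ makes $C / h_k$ grow by at least $1/2$ per step. So $C/h_k$ exceeds
  $C/\varepsilon$ after about $2C/\varepsilon$ steps. The linear phase thus takes only one step,
  and what is saved in the second phase pays both for rounding up and for the
  logarithmic term when that term is negative.

  A run that stops at step $T$ has $h_T \le \mathsf{Gap}(x^T) \le \varepsilon$, so that
  stopping never prevents the accuracy $\varepsilon$ from being reached.
\<close>

section \<open>The largest eigenvalue of a symmetric matrix\<close>

lemma norm_matrix_vector_mult_le:
  fixes A :: "real^'n^'m"
  shows "norm (A *v u) \<le> norm A * norm u"
proof -
  have "\<bar>(A *v u) $ i\<bar> \<le> norm (A $ i) * norm u" for i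
    by (metis matrix_vector_mul_component Cauchy_Schwarz_ineq2)
  then have "norm (A *v u) \<le> L2_set (\<lambda>i. norm (A $ i) * norm u) UNIV"
    unfolding norm_vec_def[of "A *v u"] by (intro L2_set_mono) auto
  also have "\<dots> = norm A * norm u"
    by (simp add: norm_vec_def[of A] L2_set_left_distrib)
  finally show ?thesis .
qed

lemma eigenvalue_le_norm:
  fixes A :: "real^'n^'n"
  assumes "v \<noteq> 0" and "A *v v = c *\<^sub>R v"
  shows "c \<le> norm A"
proof -
  have "\<bar>c\<bar> * norm v \<le> norm A * norm v"
    using norm_matrix_vector_mult_le[of A v] assms by simp
  then show ?thesis
    using assms(1) by simp
qed

lemma inner_matrix_symmetric:
  fixes A :: "real^'n^'n"
  assumes "transpose A = A"
  shows "(A *v u) \<bullet> w = u \<bullet> (A *v w)"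
  by (metis assms dot_lmul_matrix transpose_matrix_vector)

text \<open>The form $m |w|^2 - \langle A w, w\rangle$ is nonnegative and vanishes at \<open>u\<close>. Moving from
  \<open>u\<close> in the direction of the residual \<open>r\<close> changes it to first order by a negative multiple of
  $|r|^2$, so that $r = 0$.\<close>

lemma quadratic_form_maximizer_is_eigenvector:
  fixes A :: "real^'n^'n"
  assumes sym: "transpose A = A"
    and max: "\<And>w. (A *v w) \<bullet> w \<le> m * (norm w)^2"
    and u: "(A *v u) \<bullet> u = m * (norm u)^2"
  shows "A *v u = m *\<^sub>R u"
proof -
  define r where "r = A *v u - m *\<^sub>R u"
  define c where "c = m * (norm r)^2 - (A *v r) \<bullet> r"
  have c0: "c \<ge> 0"
    using max[of r] by (simp add: c_def)
  have ineq: "2 * t * (norm r)^2 \<le> t^2 * c" for t :: real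
  proof -
    have form: "(A *v (u + t *\<^sub>R r)) \<bullet> (u + t *\<^sub>R r)
        = (A *v u) \<bullet> u + 2 * (t * ((A *v u) \<bullet> r)) + t^2 * ((A *v r) \<bullet> r)"
      using inner_matrix_symmetric[OF sym, of r u]
      by (simp add: matrix_vector_right_distrib matrix_vector_mult_scaleR inner_left_distrib
          inner_right_distrib inner_commute algebra_simps power2_eq_square)
    have "(norm (u + t *\<^sub>R r))^2 = (norm u)^2 + 2 * (t * (u \<bullet> r)) + t^2 * (norm r)^2"
      unfolding power2_norm_eq_inner
      by (simp add: inner_left_distrib inner_right_distrib inner_commute
          algebra_simps power2_eq_square)
    then have "m * (norm (u + t *\<^sub>R r))^2
        = m * (norm u)^2 + 2 * (m * (t * (u \<bullet> r))) + m * (t^2 * (norm r)^2)"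
      by (simp only: distrib_left mult.left_commute[of m 2])
    moreover have "t * (norm r)^2 = t * ((A *v u) \<bullet> r) - m * (t * (u \<bullet> r))"
      unfolding power2_norm_eq_inner
      by (subst (1) r_def) (simp add: inner_diff_left right_diff_distrib)
    moreover have "t^2 * c = m * (t^2 * (norm r)^2) - t^2 * ((A *v r) \<bullet> r)"
      by (simp add: c_def right_diff_distrib)
    ultimately show ?thesis
      using max[of "u + t *\<^sub>R r"] u form by linarith
  qed
  have "(norm r)^2 = 0"
  proof (rule ccontr)
    assume "(norm r)^2 \<noteq> 0"
    then have pos: "(norm r)^2 > 0"
      by simp
    show False
    proof (cases "c = 0")
      case True
      then show False using ineq[of 1] pos by simp
    next
      case False
      with c0 have "c > 0" by simp
      then have "(norm r)^2 / c > 0" using pos by simp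
      \<comment> \<open>The step \<open>t = (norm r)^2 / c\<close> makes the linear term twice the quadratic one.\<close>
      with pos have "(norm r)^2 / c * (norm r)^2 > 0"
        by (intro mult_pos_pos)
      moreover have "((norm r)^2 / c)^2 * c = (norm r)^2 / c * (norm r)^2"
        using \<open>c > 0\<close> by (simp add: power2_eq_square)
      ultimately show False
        using ineq[of "(norm r)^2 / c"] by linarith
    qed
  qed
  then show ?thesis
    by (simp add: r_def)
qed

text \<open>The top eigenvector is a maximizer of the quadratic form on the unit sphere. Its existence
  makes the supremum defining \<open>lambda_max\<close> range over a nonempty set, on which
  \<open>lambda_max\<close> dominates the Rayleigh quotients.\<close>

lemma symmetric_matrix_top_eigenvector:
  fixes A :: "real^'n^'n"
  assumes sym: "transpose A = A"
  obtains z m where "z \<noteq> 0" and "A *v z = m *\<^sub>R z" and "\<And>w. (A *v w) \<bullet> w \<le> m * (norm w)^2"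
proof -
  have "axis undefined 1 \<in> sphere (0::real^'n) 1"
    by (simp add: norm_axis_1)
  then have "sphere (0::real^'n) 1 \<noteq> {}"
    by blast
  moreover have "continuous_on (sphere 0 1) (\<lambda>w. (A *v w) \<bullet> w)"
    by (intro continuous_intros matrix_vector_mult_linear_continuous_on)
  ultimately obtain z where z: "norm z = 1"
    and zmax: "\<And>w. norm w = 1 \<Longrightarrow> (A *v w) \<bullet> w \<le> (A *v z) \<bullet> z"
    using continuous_attains_sup[of "sphere 0 1" "\<lambda>w. (A *v w) \<bullet> w"] by auto
  define m where "m = (A *v z) \<bullet> z"
  have max: "(A *v w) \<bullet> w \<le> m * (norm w)^2" for w
  proof (cases "w = 0")
    case False
    have "(A *v (w /\<^sub>R norm w)) \<bullet> (w /\<^sub>R norm w) \<le> m"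
      unfolding m_def by (rule zmax) (use False in simp)
    then show ?thesis
      using False by (simp add: matrix_vector_mult_scaleR field_simps power2_eq_square)
  qed simp
  have "A *v z = m *\<^sub>R z"
    by (rule quadratic_form_maximizer_is_eigenvector[OF sym max]) (simp add: m_def z)
  moreover have "z \<noteq> 0"
    using z by auto
  ultimately show thesis
    using that max by blast
qed

lemma bdd_above_eigenvalues:
  fixes A :: "real^'n^'n"
  shows "bdd_above {c. \<exists>v. v \<noteq> 0 \<and> A *v v = c *\<^sub>R v}"
  by (auto intro!: bdd_aboveI[of _ "norm A"] eigenvalue_le_norm)

lemma quadratic_form_le_lambda_max:
  fixes A :: "real^'n^'n"
  assumes sym: "transpose A = A"
  shows "(A *v u) \<bullet> u \<le> lambda_max A * (norm u)^2"
proof -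
  obtain z m where "z \<noteq> 0" "A *v z = m *\<^sub>R z" and max: "\<And>w. (A *v w) \<bullet> w \<le> m * (norm w)^2"
    using symmetric_matrix_top_eigenvector[OF sym] by metis
  then have "m \<le> lambda_max A"
    unfolding lambda_max_def by (intro cSup_upper bdd_above_eigenvalues) auto
  then show ?thesis
    using max[of u] by (meson mult_right_mono order_trans zero_le_power2)
qed

lemma lambda_max_le_norm:
  fixes A :: "real^'n^'n"
  assumes sym: "transpose A = A"
  shows "lambda_max A \<le> norm A"
proof -
  obtain z m where "z \<noteq> 0" "A *v z = m *\<^sub>R z"
    using symmetric_matrix_top_eigenvector[OF sym] by metis
  then show ?thesis
    unfolding lambda_max_def by (intro cSup_least) (auto intro: eigenvalue_le_norm)
qed

section \<open>First- and second-order information along segments\<close>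

lemma gsc_ereal_rval:
  assumes "gsc M \<nu> f" and "y \<in> effdom f"
  shows "f y = ereal (rval f y)"
  using assms by (cases "f y") (auto simp: gsc_def effdom_def rval_def)

lemma gsc_has_derivative_rval:
  assumes "gsc M \<nu> f" and "y \<in> effdom f"
  shows "(rval f has_derivative (\<lambda>h. grad f y \<bullet> h)) (at y)"
proof -
  have "rval f differentiable (at y)"
    using assms by (auto simp: gsc_def C3_on_def)
  then obtain D where D: "(rval f has_derivative D) (at y)"
    by (auto simp: differentiable_def)
  define g where "g = adjoint D 1"
  have "D = (\<lambda>h. h \<bullet> g)"
    using adjoint_works[OF has_derivative_linear[OF D], of _ 1] by (simp add: g_def fun_eq_iff)
  then have "GDERIV (rval f) y :> g"
    using D by (simp only: gderiv_def)
  moreover have "g' = g" if "GDERIV (rval f) y :> g'" for g'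
  proof -
    have "(\<lambda>h. h \<bullet> g') = (\<lambda>h. h \<bullet> g)"
      using that \<open>GDERIV (rval f) y :> g\<close> unfolding gderiv_def by (rule has_derivative_unique)
    then show ?thesis
      by (metis inner_commute vector_eq_ldot)
  qed
  ultimately have "GDERIV (rval f) y :> grad f y"
    unfolding grad_def by (rule theI)
  then show ?thesis
    by (simp add: gderiv_def inner_commute)
qed

lemma gsc_has_derivative_grad:
  assumes "gsc M \<nu> f" and "y \<in> effdom f"
  shows "(grad f has_derivative (\<lambda>h. hess f y *v h)) (at y)"
proof -
  have "grad f differentiable (at y)"
    using assms by (auto simp: gsc_def C3_on_def)
  then have D: "(grad f has_derivative frechet_derivative (grad f) (at y)) (at y)"
    by (simp add: frechet_derivative_works)
  then have "linear (frechet_derivative (grad f) (at y))"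
    by (rule has_derivative_linear)
  then have "frechet_derivative (grad f) (at y) = (\<lambda>h. hess f y *v h)"
    by (simp add: hess_def matrix_works)
  with D show ?thesis
    by simp
qed

lemma gsc_derivative_along_segment:
  assumes "gsc M \<nu> f" and "a + t *\<^sub>R v \<in> effdom f"
  shows "((\<lambda>t. rval f (a + t *\<^sub>R v)) has_real_derivative grad f (a + t *\<^sub>R v) \<bullet> v) (at t)"
proof -
  have "((\<lambda>t. a + t *\<^sub>R v) has_derivative (\<lambda>h. h *\<^sub>R v)) (at t)"
    by (auto intro!: derivative_eq_intros)
  from has_derivative_compose[OF this gsc_has_derivative_rval[OF assms]]
  show ?thesis
    by (simp add: has_field_derivative_def mult_commute_abs)
qed

lemma gsc_second_derivative_along_segment:
  assumes "gsc M \<nu> f" and "a + t *\<^sub>R v \<in> effdom f"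
  shows "((\<lambda>t. grad f (a + t *\<^sub>R v) \<bullet> v) has_real_derivative (hess f (a + t *\<^sub>R v) *v v) \<bullet> v) (at t)"
proof -
  have "((\<lambda>t. a + t *\<^sub>R v) has_derivative (\<lambda>h. h *\<^sub>R v)) (at t)"
    by (auto intro!: derivative_eq_intros)
  from has_derivative_inner_left[OF has_derivative_compose[OF this gsc_has_derivative_grad[OF assms]], of v]
  show ?thesis
    by (simp add: has_field_derivative_def mult_commute_abs matrix_vector_mult_scaleR)
qed

text \<open>The one-dimensional tangent inequality is applied to the restriction of \<open>f\<close> to the line through
  the two points.\<close>

lemma gsc_above_tangent:
  assumes gsc: "gsc M \<nu> f" and x: "x \<in> effdom f" and y: "y \<in> effdom f"
  shows "rval f y \<ge> rval f x + grad f x \<bullet> (y - x)"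
proof -
  define A where "A = {t::real. x + t *\<^sub>R (y - x) \<in> effdom f}"
  have conv: "convex_on (effdom f) (rval f)" and op: "open (effdom f)"
    using gsc by (auto simp: gsc_def)
  have comb: "x + ((1 - u) * t + u * t') *\<^sub>R (y - x)
      = (1 - u) *\<^sub>R (x + t *\<^sub>R (y - x)) + u *\<^sub>R (x + t' *\<^sub>R (y - x))" for u t t' :: real
    by (simp add: algebra_simps)
  have "convex A"
    unfolding convex_alt A_def
    using convexD_alt[OF convex_on_imp_convex[OF conv]] by (auto simp: comb)
  moreover have "open A"
    unfolding A_def using open_vimage[OF op, of "\<lambda>t. x + t *\<^sub>R (y - x)"]
    by (simp add: vimage_def continuous_intros)
  moreover have "convex_on A (\<lambda>t. rval f (x + t *\<^sub>R (y - x)))"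
    using \<open>convex A\<close> convex_onD[OF conv]
    by (intro convex_onI) (auto simp: A_def comb)
  moreover have "0 \<in> A" "1 \<in> A"
    using x y by (auto simp: A_def)
  ultimately have "rval f (x + 1 *\<^sub>R (y - x)) - rval f (x + 0 *\<^sub>R (y - x))
      \<ge> (grad f (x + 0 *\<^sub>R (y - x)) \<bullet> (y - x)) * (1 - 0)"
    using gsc_derivative_along_segment[OF gsc, of x 0 "y - x"] x
    by (intro convex_on_imp_above_tangent[where A = A])
       (auto simp: interior_open convex_connected intro: has_field_derivative_at_within)
  then show ?thesis
    by simp
qed

text \<open>The curvature is only bounded on the segment itself, because only the part inside the level set
  is under control. The slope bound is kept separate from its integrated form below, as it is what
  keeps \<open>f\<close> decreasing at a point where the segment might leave the level set.\<close>

lemma gsc_slope_upper_bound: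
  assumes gsc: "gsc M \<nu> f" and \<tau>: "\<tau> \<ge> 0"
    and dom: "\<And>t. 0 \<le> t \<Longrightarrow> t \<le> \<tau> \<Longrightarrow> a + t *\<^sub>R v \<in> effdom f"
    and curv: "\<And>t. 0 \<le> t \<Longrightarrow> t \<le> \<tau> \<Longrightarrow> (hess f (a + t *\<^sub>R v) *v v) \<bullet> v \<le> K"
  shows "grad f (a + \<tau> *\<^sub>R v) \<bullet> v \<le> grad f a \<bullet> v + \<tau> * K"
proof -
  have "(\<lambda>t. grad f (a + t *\<^sub>R v) \<bullet> v - t * K) 0 \<ge> (\<lambda>t. grad f (a + t *\<^sub>R v) \<bullet> v - t * K) \<tau>"
  proof (rule DERIV_nonpos_imp_nonincreasing[OF \<tau>])
    fix u assume u: "0 \<le> u" "u \<le> \<tau>"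
    have "((\<lambda>t. grad f (a + t *\<^sub>R v) \<bullet> v - t * K) has_real_derivative
        (hess f (a + u *\<^sub>R v) *v v) \<bullet> v - K) (at u)"
      using gsc_second_derivative_along_segment[OF gsc dom, of u] u
      by (auto intro!: derivative_eq_intros)
    then show "\<exists>D. ((\<lambda>t. grad f (a + t *\<^sub>R v) \<bullet> v - t * K) has_real_derivative D) (at u) \<and> D \<le> 0"
      using curv[of u] u by force
  qed
  then show ?thesis by simp
qed

lemma gsc_quadratic_upper_bound:
  assumes gsc: "gsc M \<nu> f" and \<tau>: "\<tau> \<ge> 0"
    and dom: "\<And>t. 0 \<le> t \<Longrightarrow> t \<le> \<tau> \<Longrightarrow> a + t *\<^sub>R v \<in> effdom f"
    and curv: "\<And>t. 0 \<le> t \<Longrightarrow> t \<le> \<tau> \<Longrightarrow> (hess f (a + t *\<^sub>R v) *v v) \<bullet> v \<le> K"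
  shows "rval f (a + \<tau> *\<^sub>R v) \<le> rval f a + \<tau> * (grad f a \<bullet> v) + \<tau>^2 * K / 2"
proof -
  define \<psi> where "\<psi> t = rval f (a + t *\<^sub>R v) - t * (grad f a \<bullet> v) - t^2 * K / 2" for t
  have "\<psi> 0 \<ge> \<psi> \<tau>"
  proof (rule DERIV_nonpos_imp_nonincreasing[OF \<tau>])
    fix u assume u: "0 \<le> u" "u \<le> \<tau>"
    have "(\<psi> has_real_derivative grad f (a + u *\<^sub>R v) \<bullet> v - grad f a \<bullet> v - u * K) (at u)"
      unfolding \<psi>_def using gsc_derivative_along_segment[OF gsc dom, of u] u
      by (auto intro!: derivative_eq_intros)
    moreover have "grad f (a + u *\<^sub>R v) \<bullet> v \<le> grad f a \<bullet> v + u * K"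
      using u by (intro gsc_slope_upper_bound[OF gsc] dom curv) auto
    ultimately show "\<exists>D. (\<psi> has_real_derivative D) (at u) \<and> D \<le> 0"
      by (intro exI conjI) auto
  qed
  then show ?thesis
    by (simp add: \<psi>_def)
qed

section \<open>The initial level set\<close>

lemma lsc_closed_sublevel:
  fixes f :: "'a::t1_space \<Rightarrow> ereal"
  assumes "lsc f"
  shows "closed {y. f y \<le> c}"
  unfolding closed_limpt
proof (intro allI impI)
  fix y assume y: "y islimpt {y. f y \<le> c}"
  have "f y \<le> c"
  proof (rule ccontr)
    assume "\<not> f y \<le> c"
    then have "c < Liminf (at y) f"
      using assms unfolding lsc_def by (meson not_le less_le_trans)
    then have "\<forall>\<^sub>F z in at y. c < f z"
      by (rule less_LiminfD)
    then have "\<not> (\<exists>\<^sub>F z in at y. z \<in> {y. f y \<le> c})"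
      by (simp add: not_frequently not_le)
    with y show False
      by (simp add: islimpt_conv_frequently_at)
  qed
  then show "y \<in> {y. f y \<le> c}"
    by simp
qed

lemma level_set_eq:
  assumes "x0 \<in> effdom f"
  shows "level_set f X x0 = X \<inter> {y. f y \<le> f x0}"
  using assms by (auto simp: level_set_def effdom_def)

text \<open>Lower semicontinuity of the extended-valued function is what keeps the level set away from the
  boundary of the domain, and so makes it closed.\<close>

lemma gsc_compact_level_set:
  assumes "gsc M \<nu> f" and "compact X" and "x0 \<in> effdom f"
  shows "compact (level_set f X x0)"
  using assms by (simp add: level_set_eq compact_Int_closed lsc_closed_sublevel gsc_def)

lemma gsc_mem_level_set:
  assumes "gsc M \<nu> f" and "x0 \<in> effdom f"
  shows "y \<in> level_set f X x0 \<longleftrightarrow> y \<in> X \<and> y \<in> effdom f \<and> rval f y \<le> rval f x0"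
  using gsc_ereal_rval[OF assms(1)] assms(2) by (auto simp: level_set_def)

lemma gsc_convex_level_set:
  assumes gsc: "gsc M \<nu> f" and X: "convex X" and x0: "x0 \<in> effdom f"
  shows "convex (level_set f X x0)"
proof -
  have conv: "convex_on (effdom f) (rval f)"
    using gsc by (simp add: gsc_def)
  have "convex {y \<in> effdom f. rval f y \<le> rval f x0}"
    unfolding convex_alt
  proof (intro ballI allI impI CollectI conjI)
    fix y z and u :: real
    assume y: "y \<in> {y \<in> effdom f. rval f y \<le> rval f x0}"
      and z: "z \<in> {y \<in> effdom f. rval f y \<le> rval f x0}" and u: "0 \<le> u \<and> u \<le> 1"
    show "(1 - u) *\<^sub>R y + u *\<^sub>R z \<in> effdom f"
      using convexD_alt[OF convex_on_imp_convex[OF conv]] y z u by auto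
    have "rval f ((1 - u) *\<^sub>R y + u *\<^sub>R z) \<le> (1 - u) * rval f y + u * rval f z"
      using convex_onD[OF conv] y z u by auto
    also have "\<dots> \<le> rval f x0"
      using y z u by (intro convex_bound_le) auto
    finally show "rval f ((1 - u) *\<^sub>R y + u *\<^sub>R z) \<le> rval f x0" .
  qed
  moreover have "level_set f X x0 = X \<inter> {y \<in> effdom f. rval f y \<le> rval f x0}"
    using gsc_mem_level_set[OF gsc x0] by auto
  ultimately show ?thesis
    using X by (simp add: convex_Int)
qed

text \<open>Compactness of the level set and continuity of the Hessian bound the family whose supremum is
  \<open>L_grad\<close>; without a bound that supremum would be an unspecified number.\<close>

lemma quadratic_form_le_L_grad:
  assumes gsc: "gsc M \<nu> f" and X: "compact X" and x0: "x0 \<in> effdom f"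
    and cont: "continuous_on (X \<inter> effdom f) (hess f)"
    and sym: "\<And>y. y \<in> X \<inter> effdom f \<Longrightarrow> transpose (hess f y) = hess f y"
    and y: "y \<in> level_set f X x0"
  shows "(hess f y *v u) \<bullet> u \<le> L_grad f X x0 * (norm u)^2"
proof -
  have sub: "level_set f X x0 \<subseteq> X \<inter> effdom f"
    by (auto simp: level_set_def)
  have "compact (hess f ` level_set f X x0)"
    by (intro compact_continuous_image continuous_on_subset[OF cont sub]
        gsc_compact_level_set[OF gsc X x0])
  then obtain B where B: "\<And>z. z \<in> level_set f X x0 \<Longrightarrow> norm (hess f z) \<le> B"
    using compact_imp_bounded bounded_iff by (metis imageI)
  have "bdd_above ((\<lambda>z. lambda_max (hess f z)) ` level_set f X x0)"
    using B sub lambda_max_le_norm[OF sym] by (intro bdd_aboveI2[of _ _ B]) (meson order_trans subsetD)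
  then have "lambda_max (hess f y) \<le> L_grad f X x0"
    unfolding L_grad_def by (rule cSUP_upper[OF y])
  then have "lambda_max (hess f y) * (norm u)^2 \<le> L_grad f X x0 * (norm u)^2"
    by (rule mult_right_mono) simp
  moreover have "(hess f y *v u) \<bullet> u \<le> lambda_max (hess f y) * (norm u)^2"
    using y sub by (intro quadratic_form_le_lambda_max sym) auto
  ultimately show ?thesis
    by linarith
qed

section \<open>Counting steps of the recursion\<close>

text \<open>The values at \<open>\<beta>\<close> and at \<open>\<alpha>\<close> differ by a square and by the product of $\beta - \alpha$ with the
  derivative at \<open>\<alpha>\<close>. That product is nonnegative: the derivative vanishes if $\alpha = g / w$, and
  otherwise $\alpha = 1 \ge \beta$ with a nonpositive derivative.\<close>

lemma optimal_step_minimizes_quadratic: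
  fixes g w \<beta> :: real
  assumes "w > 0" and "0 \<le> \<beta>" "\<beta> \<le> 1" and "\<alpha> = min 1 (g / w)"
  shows "- \<alpha> * g + \<alpha>^2 * w / 2 \<le> - \<beta> * g + \<beta>^2 * w / 2"
proof -
  have "(- \<beta> * g + \<beta>^2 * w / 2) - (- \<alpha> * g + \<alpha>^2 * w / 2)
      = w / 2 * (\<beta> - \<alpha>)^2 + (\<beta> - \<alpha>) * (w * \<alpha> - g)"
    by (simp add: field_simps power2_eq_square)
  moreover have "(\<beta> - \<alpha>) * (w * \<alpha> - g) \<ge> 0"
  proof (cases "g / w \<le> 1")
    case True
    then show ?thesis using assms by (simp add: min_def)
  next
    case False
    then have "\<alpha> = 1" "w \<le> g" using assms by (auto simp: min_def field_simps)
    then show ?thesis using assms by (simp add: mult_nonpos_nonpos)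
  qed
  ultimately show ?thesis
    using \<open>w > 0\<close> by (smt (verit) mult_nonneg_nonneg zero_le_power2 divide_nonneg_nonneg)
qed

text \<open>With $y_k = C / h_k$ the recursion gives $y_1 \ge 2$ if $y_0 \le 1$, and
  $y_{k+1} \ge y_k + 1/2$ if $y_k > 1$; both follow from the choice $\beta = \min\{1, h_k / C\}$.
  Since $y_{n-1} < C / \varepsilon$, this bounds \<open>n\<close>. The bound has to hold without rounding. If
  $y_0 > 1$, the count is below $2 C / \varepsilon + 1 - 2 y_0$ and the logarithmic term is
  $- \log_2 y_0$, so that $\log_2 y \le 2 y - 1$ for $y \ge 1$ is what is needed. If $y_0 \le 1$,
  the logarithmic term is nonnegative and the slack $y_1 \ge 2$ covers the first step, except for
  $n = 1$, where either $2 C / \varepsilon \ge 1$ or $h_0 > \varepsilon > 2 C$ makes the logarithmic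
  term at least one.\<close>

lemma frank_wolfe_recursion_count:
  fixes h :: "nat \<Rightarrow> real"
  assumes C: "C > 0" and \<epsilon>: "\<epsilon> > 0" and n: "n > 0"
    and big: "\<And>k. k < n \<Longrightarrow> h k > \<epsilon>"
    and step: "\<And>k \<beta>. Suc k < n \<Longrightarrow> 0 \<le> \<beta> \<Longrightarrow> \<beta> \<le> 1 \<Longrightarrow> h (Suc k) \<le> (1 - \<beta>) * h k + \<beta>^2 / 2 * C"
  shows "real n \<le> ln (C / h 0) / ln (1/2) + 2 * C / \<epsilon>"
proof -
  have pos: "h k > 0" if "k < n" for k
    using big[OF that] \<epsilon> by simp
  have first: "C / h (Suc k) \<ge> 2" if "Suc k < n" "h k \<ge> C" for k
    using step[of k 1] that pos[of "Suc k"] by (simp add: field_simps)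
  have rec: "C / h (Suc k) \<ge> C / h k + 1 / 2" if k: "Suc k < n" "h k < C" for k
  proof -
    have hk: "h k > 0" "h (Suc k) > 0"
      using pos k(1) by auto
    have "h (Suc k) \<le> (1 - h k / C) * h k + (h k / C)^2 / 2 * C"
      using step[OF k(1), of "h k / C"] C hk k(2) by simp
    also have "\<dots> = h k - (h k)^2 / (2 * C)"
      using C by (simp add: field_simps power2_eq_square)
    \<comment> \<open>The factor \<open>2 * C + h k\<close> clears denominators: with \<open>u = h k / C\<close> the claim is
      \<open>(1 - u / 2) * (1 + u / 2) \<le> 1\<close>.\<close>
    finally have "h (Suc k) * (2 * C + h k) \<le> (h k - (h k)^2 / (2 * C)) * (2 * C + h k)"
      using hk C by (intro mult_right_mono) auto
    also have "\<dots> = 2 * C * h k - (h k)^3 / (2 * C)"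
      using C by (simp add: field_simps power2_eq_square power3_eq_cube)
    also have "\<dots> \<le> 2 * C * h k"
      using hk C by simp
    finally show ?thesis
      using hk C by (simp add: field_simps)
  qed
  have iter: "C / h (j + i) \<ge> C / h j + real i / 2" if "j + i < n" "h j < C" for i j
    using that(1)
  proof (induction i)
    case (Suc i)
    then have IH: "C / h (j + i) \<ge> C / h j + real i / 2" by simp
    have "C / h j > 1"
      using that pos[of j] by (simp add: field_simps)
    with IH have "C / h (j + i) > 1" by simp
    then have "h (j + i) < C"
      using pos[of "j + i"] Suc.prems by (simp add: field_simps)
    with rec[of "j + i"] IH Suc.prems show ?case by (simp add: field_simps)
  qed simp
  have ln2: "2 / 3 \<le> ln (2::real)"
    by (rule ln2_ge_two_thirds)
  have log: "ln (C / h 0) / ln (1/2) = ln (h 0 / C) / ln 2"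
    using C pos[of 0] n by (simp add: ln_div field_simps)
  have last: "C / h (n - 1) < C / \<epsilon>"
    using big[of "n - 1"] n C \<epsilon> by (simp add: frac_less2)
  show ?thesis
  proof (cases "h 0 < C")
    case True
    have "C / h 0 + real (n - 1) / 2 < C / \<epsilon>"
      using iter[of 0 "n - 1"] True n last by simp
    moreover have "ln (C / h 0) / ln 2 \<le> 2 * (C / h 0) - 1"
    proof -
      have y: "C / h 0 \<ge> 1"
        using True pos[of 0] n by simp
      have "ln (C / h 0) \<le> C / h 0 - 1"
        by (rule ln_le_minus_one) (use y in simp)
      also have "\<dots> \<le> 2 * (C / h 0 - 1) * ln 2"
        using mult_left_mono[of "1 / 2" "ln 2" "2 * (C / h 0 - 1)"] y ln2 by simp
      also have "\<dots> \<le> (2 * (C / h 0) - 1) * ln 2"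
        using ln2 by (intro mult_right_mono) auto
      finally show ?thesis
        using ln2 by (simp add: divide_le_eq)
    qed
    moreover have "ln (h 0 / C) = - ln (C / h 0)"
      using C pos[of 0] n by (simp add: ln_div)
    moreover have "real (n - 1) = real n - 1" "2 * C / \<epsilon> = 2 * (C / \<epsilon>)"
      using n by (simp_all add: of_nat_diff)
    moreover have "ln (h 0 / C) / ln 2 = - (ln (C / h 0) / ln 2)"
      using calculation(3) by simp
    ultimately show ?thesis
      unfolding log by linarith
  next
    case False
    then have log0: "ln (h 0 / C) / ln 2 \<ge> 0"
      using C by simp
    show ?thesis
    proof (cases "n = 1")
      case True
      show ?thesis
      proof (cases "\<epsilon> \<le> 2 * C")
        case small: True
        then have "2 * C / \<epsilon> \<ge> 1"
          using \<epsilon> by simp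
        then show ?thesis
          using log0 True unfolding log by simp
      next
        case False
        then have "h 0 / C \<ge> 2"
          using big[of 0] n C by (simp add: field_simps)
        then have "ln 2 \<le> ln (h 0 / C)"
          by simp
        then have "ln (h 0 / C) / ln 2 \<ge> 1"
          using ln2 by simp
        then show ?thesis
          using True C \<epsilon> unfolding log by (simp add: add_increasing2)
      qed
    next
      case ne: False
      then have n2: "n \<ge> 2"
        using n by simp
      have h1: "C / h 1 \<ge> 2"
        using first[of 0] n2 False by simp
      then have "h 1 < C"
        using pos[of 1] n2 C by (simp add: field_simps)
      from iter[of 1 "n - 2"] this h1 n2 last have "2 + real (n - 2) / 2 < C / \<epsilon>"
        by (simp add: Suc_diff_Suc numeral_2_eq_2)
      moreover have "real (n - 2) = real n - 2" "2 * C / \<epsilon> = 2 * (C / \<epsilon>)"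
        using n2 by (simp_all add: of_nat_diff)
      ultimately show ?thesis
        using log0 unfolding log by linarith
    qed
  qed
qed

section \<open>Acceptance and descent in the backtracking\<close>

text \<open>The point \<open>x0\<close> is fixed because all curvature bounds refer to its level set.\<close>

locale frank_wolfe_problem =
  fixes f :: "real^'n \<Rightarrow> ereal" and X :: "(real^'n) set" and s :: "real^'n \<Rightarrow> real^'n"
    and x0 :: "real^'n" and M \<nu> :: real
  assumes gsc: "gsc M \<nu> f"
    and convex_X: "convex X" and compact_X: "compact X"
    and lmo: "lmo f X s"
    and x0: "x0 \<in> X \<inter> effdom f"
    and continuous_hess: "continuous_on (X \<inter> effdom f) (hess f)"
    and symmetric_hess: "\<And>y. y \<in> X \<inter> effdom f \<Longrightarrow> transpose (hess f y) = hess f y"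
begin

lemma mem_level_set:
  "y \<in> level_set f X x0 \<longleftrightarrow> y \<in> X \<and> y \<in> effdom f \<and> rval f y \<le> rval f x0"
  using gsc_mem_level_set[OF gsc] x0 by blast

lemma s_mem: "y \<in> X \<inter> effdom f \<Longrightarrow> s y \<in> X"
  using lmo by (auto simp: lmo_def is_arg_min_def)

lemma Gap_eq:
  assumes "y \<in> X \<inter> effdom f"
  shows "Gap f X y = - (grad f y \<bullet> v_FW s y)"
proof -
  have "grad f y \<bullet> s y \<le> grad f y \<bullet> d" if "d \<in> X" for d
    using lmo assms that unfolding lmo_def is_arg_min_def by (meson not_le)
  then have "Gap f X y = grad f y \<bullet> (y - s y)"
    unfolding Gap_def using s_mem[OF assms]
    by (intro cSup_eq_maximum) (auto simp: inner_diff_right)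
  then show ?thesis
    by (simp add: v_FW_def inner_diff_right)
qed

lemma suboptimality_le_Gap:
  assumes y: "y \<in> X \<inter> effdom f" and z: "z \<in> X \<inter> effdom f"
  shows "rval f y - rval f z \<le> Gap f X y"
proof -
  have "grad f y \<bullet> s y \<le> grad f y \<bullet> z"
    using lmo y z unfolding lmo_def is_arg_min_def by (meson IntE not_le)
  moreover have "rval f z \<ge> rval f y + grad f y \<bullet> (z - y)"
    using y z by (intro gsc_above_tangent[OF gsc]) auto
  ultimately show ?thesis
    using Gap_eq[OF y] by (simp add: v_FW_def inner_diff_right)
qed

lemma segment_in_X:
  assumes "y \<in> X \<inter> effdom f" and "0 \<le> t" "t \<le> 1"
  shows "y + t *\<^sub>R v_FW s y \<in> X"
proof -
  have "(1 - t) *\<^sub>R y + t *\<^sub>R s y \<in> X"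
    using assms s_mem[OF assms(1)] by (intro convexD_alt[OF convex_X]) auto
  then show ?thesis
    by (simp add: v_FW_def algebra_simps)
qed

lemma norm_v_FW_pos:
  assumes "y \<in> X \<inter> effdom f" and "Gap f X y > 0"
  shows "norm (v_FW s y) > 0"
  using Gap_eq[OF assms(1)] assms(2) by auto

lemma norm_v_FW_le_diameter:
  assumes "y \<in> X \<inter> effdom f"
  shows "norm (v_FW s y) \<le> diameter X"
  using diameter_bounded_bound[OF compact_imp_bounded[OF compact_X] s_mem[OF assms], of y] assms
  by (simp add: v_FW_def dist_norm)

lemma step_size_bounds:
  assumes y: "y \<in> X \<inter> effdom f" and gap: "Gap f X y > 0" and L: "L > 0"
  shows "0 < step_size f X s y L" and "step_size f X s y L \<le> 1"
    and "step_size f X s y L * (L * (norm (v_FW s y))^2) \<le> Gap f X y"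
proof -
  have pos: "L * (norm (v_FW s y))^2 > 0"
    using L norm_v_FW_pos[OF y gap] by simp
  then show "0 < step_size f X s y L" "step_size f X s y L \<le> 1"
    using gap by (auto simp: step_size_def)
  have "step_size f X s y L \<le> Gap f X y / (L * (norm (v_FW s y))^2)"
    by (simp add: step_size_def)
  then show "step_size f X s y L * (L * (norm (v_FW s y))^2) \<le> Gap f X y"
    using pos by (simp add: pos_le_divide_eq)
qed

text \<open>Let \<open>\<tau>\<close> be the largest step up to the prescribed \<open>\<alpha>\<close> that ends in the level set. By
  convexity the whole segment up to \<open>\<tau>\<close> is in the level set, so the Hessian bound holds along it.
  If \<open>\<tau> < \<alpha>\<close>, then the slope at \<open>\<tau>\<close> is at most $-\mathsf{Gap} + \tau L |v|^2 < 0$, since $\alpha$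
  is at most the zero $\mathsf{Gap} / (L |v|^2)$ of this expression. As the domain is open, \<open>f\<close> is
  finite and decreasing just after \<open>\<tau>\<close>, so the level set extends further, a contradiction. With
  $\tau = \alpha$, the quadratic upper bound is the acceptance test.\<close>

lemma accepted_if_L_grad_le:
  assumes y: "y \<in> level_set f X x0" and gap: "Gap f X y > 0"
    and L: "L > 0" "L_grad f X x0 \<le> L"
  shows "accepted f X s y L"
proof -
  have yX: "y \<in> X \<inter> effdom f"
    using y mem_level_set by blast
  define v where "v = v_FW s y"
  define \<alpha> where "\<alpha> = step_size f X s y L"
  define K where "K = L * (norm v)^2"
  have \<alpha>: "0 < \<alpha>" "\<alpha> \<le> 1" "\<alpha> * K \<le> Gap f X y"
    using step_size_bounds[OF yX gap L(1)] by (simp_all add: \<alpha>_def K_def v_def)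
  have "K > 0"
    using L(1) norm_v_FW_pos[OF yX gap] by (simp add: K_def v_def)
  define A where "A = {0..\<alpha>} \<inter> (\<lambda>t. y + t *\<^sub>R v) -` level_set f X x0"
  have "compact (level_set f X x0)"
    using gsc_compact_level_set[OF gsc compact_X] x0 by blast
  then have "closed A"
    unfolding A_def
    by (intro continuous_closed_preimage continuous_intros closed_real_atLeastAtMost compact_imp_closed)
  moreover have "bounded A"
    by (rule bounded_subset[of "{0..\<alpha>}"]) (auto simp: A_def)
  ultimately have "compact A"
    by (simp add: compact_eq_bounded_closed)
  moreover have "0 \<in> A"
    using y \<alpha>(1) by (simp add: A_def)
  ultimately obtain \<tau> where \<tau>A: "\<tau> \<in> A" and \<tau>max: "\<And>t. t \<in> A \<Longrightarrow> t \<le> \<tau>"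
    using compact_attains_sup[of A] by blast
  then have \<tau>: "0 \<le> \<tau>" "\<tau> \<le> \<alpha>" "y + \<tau> *\<^sub>R v \<in> level_set f X x0"
    by (auto simp: A_def)
  have seg: "y + t *\<^sub>R v \<in> level_set f X x0" if t: "0 \<le> t" "t \<le> \<tau>" for t
  proof (cases "\<tau> = 0")
    case True
    then show ?thesis using t y by simp
  next
    case False
    have "convex (level_set f X x0)"
      using gsc_convex_level_set[OF gsc convex_X] x0 by blast
    then have "(1 - t / \<tau>) *\<^sub>R y + (t / \<tau>) *\<^sub>R (y + \<tau> *\<^sub>R v) \<in> level_set f X x0"
      using t \<tau> y False by (intro convexD_alt) auto
    then show ?thesis
      using False by (simp add: algebra_simps)
  qed
  have dom: "y + t *\<^sub>R v \<in> effdom f" if "0 \<le> t" "t \<le> \<tau>" for t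
    using seg[OF that] mem_level_set by blast
  have curv: "(hess f (y + t *\<^sub>R v) *v v) \<bullet> v \<le> K" if "0 \<le> t" "t \<le> \<tau>" for t
  proof -
    have "(hess f (y + t *\<^sub>R v) *v v) \<bullet> v \<le> L_grad f X x0 * (norm v)^2"
      using x0 by (intro quadratic_form_le_L_grad[OF gsc compact_X _ continuous_hess symmetric_hess]
          seg that) auto
    also have "\<dots> \<le> K"
      unfolding K_def using L(2) by (intro mult_right_mono) auto
    finally show ?thesis .
  qed
  have "\<tau> = \<alpha>"
  proof (rule ccontr)
    assume "\<tau> \<noteq> \<alpha>"
    with \<tau> have less: "\<tau> < \<alpha>"
      by simp
    have "grad f (y + \<tau> *\<^sub>R v) \<bullet> v \<le> grad f y \<bullet> v + \<tau> * K"
      by (rule gsc_slope_upper_bound[OF gsc \<tau>(1) dom curv])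
    moreover have "\<tau> * K < \<alpha> * K"
      using less \<open>K > 0\<close> by simp
    ultimately have neg: "grad f (y + \<tau> *\<^sub>R v) \<bullet> v < 0"
      using \<alpha>(3) Gap_eq[OF yX] by (simp add: v_def)
    obtain d where d: "d > 0"
      and dec: "\<And>h. 0 < h \<Longrightarrow> h < d \<Longrightarrow> rval f (y + (\<tau> + h) *\<^sub>R v) < rval f (y + \<tau> *\<^sub>R v)"
      using DERIV_neg_dec_right[OF gsc_derivative_along_segment[OF gsc dom[OF \<tau>(1) order_refl]] neg]
      by blast
    have "open (effdom f)"
      using gsc by (simp add: gsc_def)
    then have "open ((\<lambda>t. y + t *\<^sub>R v) -` effdom f)"
      by (intro open_vimage continuous_intros)
    moreover have "\<tau> \<in> (\<lambda>t. y + t *\<^sub>R v) -` effdom f"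
      using dom[OF \<tau>(1)] by simp
    ultimately obtain e where e: "e > 0" and ball: "ball \<tau> e \<subseteq> (\<lambda>t. y + t *\<^sub>R v) -` effdom f"
      using open_contains_ball by blast
    define h where "h = min (min d e) (\<alpha> - \<tau>) / 2"
    have h: "0 < h" "h < d" "h < e" "\<tau> + h \<le> \<alpha>"
      using d e less by (auto simp: h_def min_def field_simps)
    have "\<tau> + h \<in> ball \<tau> e"
      using h by (simp add: dist_real_def)
    then have "y + (\<tau> + h) *\<^sub>R v \<in> effdom f"
      using ball by blast
    moreover have "y + (\<tau> + h) *\<^sub>R v \<in> X"
      unfolding v_def using h \<tau>(1) \<alpha>(2) by (intro segment_in_X[OF yX]) auto
    moreover have "rval f (y + (\<tau> + h) *\<^sub>R v) \<le> rval f x0"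
      using dec[OF h(1,2)] \<tau>(3) mem_level_set by force
    ultimately have "\<tau> + h \<in> A"
      using h \<tau>(1) mem_level_set by (auto simp: A_def)
    with \<tau>max[of "\<tau> + h"] h(1) show False
      by simp
  qed
  moreover have "rval f (y + \<tau> *\<^sub>R v) \<le> rval f y + \<tau> * (grad f y \<bullet> v) + \<tau>^2 * K / 2"
    by (rule gsc_quadratic_upper_bound[OF gsc \<tau>(1) dom curv])
  moreover have "y + \<tau> *\<^sub>R v \<in> effdom f"
    using dom[OF \<tau>(1)] by simp
  ultimately show ?thesis
    using Gap_eq[OF yX]
    by (simp add: accepted_def Let_def Q_L_def K_def v_def \<alpha>_def)
qed

text \<open>Either the initial trial value, which does not exceed the previous estimate, is accepted, or the
  last trial value before the accepted one was rejected and hence below \<open>L_grad\<close>.\<close>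

lemma backtrack_estimate_bounds:
  assumes y: "y \<in> level_set f X x0" and gap: "Gap f X y > 0"
    and \<gamma>: "\<gamma>u > 1" "\<gamma>d > 0"
    and Lprev: "0 < Lprev" "Lprev \<le> B" and B: "\<gamma>u * L_grad f X x0 \<le> B"
    and bt: "backtrack f X s \<gamma>u \<gamma>d y Lprev L"
  shows "0 < L" and "L \<le> B" and "accepted f X s y L"
proof -
  obtain L0 i where L0: "\<gamma>d * Lprev \<le> L0" "L0 \<le> Lprev" and L: "L = \<gamma>u^i * L0"
    and acc: "accepted f X s y L" and rej: "\<And>j. j < i \<Longrightarrow> \<not> accepted f X s y (\<gamma>u^j * L0)"
    using bt unfolding backtrack_def by fastforce
  show "accepted f X s y L" by (rule acc)
  have "L0 > 0"
    using \<gamma>(2) Lprev(1) L0(1) by (meson less_le_trans mult_pos_pos)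
  then have pos: "\<gamma>u^j * L0 > 0" for j
    using \<gamma>(1) by simp
  then show "0 < L"
    by (simp add: L)
  show "L \<le> B"
  proof (cases i)
    case 0
    then show ?thesis using L L0 Lprev by simp
  next
    case (Suc j)
    have "\<gamma>u^j * L0 < L_grad f X x0"
      using rej[of j] accepted_if_L_grad_le[OF y gap pos[of j]] Suc by force
    then have "\<gamma>u * (\<gamma>u^j * L0) \<le> \<gamma>u * L_grad f X x0"
      using \<gamma>(1) by simp
    then show ?thesis
      using B by (simp add: L Suc mult.assoc)
  qed
qed

lemma accepted_step_descent:
  assumes y: "y \<in> X \<inter> effdom f" and gap: "Gap f X y > 0" and L: "L > 0"
    and acc: "accepted f X s y L" and \<beta>: "0 \<le> \<beta>" "\<beta> \<le> 1"
  shows "rval f (y + step_size f X s y L *\<^sub>R v_FW s y)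
    \<le> rval f y - \<beta> * Gap f X y + \<beta>^2 * (L * (norm (v_FW s y))^2) / 2"
proof -
  have "L * (norm (v_FW s y))^2 > 0"
    using L norm_v_FW_pos[OF y gap] by simp
  from optimal_step_minimizes_quadratic[OF this \<beta> step_size_def[of f X s y L]] acc show ?thesis
    by (simp add: accepted_def Let_def Q_L_def algebra_simps)
qed

lemma accepted_step_in_level_set:
  assumes y: "y \<in> level_set f X x0" and gap: "Gap f X y > 0" and L: "L > 0"
    and acc: "accepted f X s y L"
  shows "y + step_size f X s y L *\<^sub>R v_FW s y \<in> level_set f X x0"
proof -
  have yX: "y \<in> X \<inter> effdom f"
    using y mem_level_set by blast
  have "y + step_size f X s y L *\<^sub>R v_FW s y \<in> effdom f"
    using acc by (simp add: accepted_def Let_def)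
  moreover have "y + step_size f X s y L *\<^sub>R v_FW s y \<in> X"
    using step_size_bounds[OF yX gap L] by (intro segment_in_X[OF yX]) auto
  moreover have "rval f (y + step_size f X s y L *\<^sub>R v_FW s y) \<le> rval f y"
    using accepted_step_descent[OF yX gap L acc, of 0] by simp
  ultimately show ?thesis
    using y mem_level_set by auto
qed

text \<open>The level set and the estimate have to be carried along together: the bound on the next estimate
  needs the Hessian bound at the current iterate, and the descent to the next iterate needs a positive
  estimate.\<close>

lemma run_invariant:
  assumes run: "LBTFWGSC_run f X s \<gamma>u \<gamma>d \<epsilon> x est T" and "x 0 = x0"
    and \<gamma>: "\<gamma>u > 1" "\<gamma>d > 0" and \<epsilon>: "\<epsilon> > 0"
    and B: "0 < est 0" "est 0 \<le> B" "\<gamma>u * L_grad f X x0 \<le> B"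
    and k: "enat k \<le> T"
  shows "x k \<in> level_set f X x0 \<and> 0 < est k \<and> est k \<le> B"
  using k
proof (induction k)
  case 0
  then show ?case
    using x0 B \<open>x 0 = x0\<close> mem_level_set by simp
next
  case (Suc k)
  then have kT: "enat k < T"
    by (simp add: Suc_ile_eq)
  with Suc.IH have IH: "x k \<in> level_set f X x0" "0 < est k" "est k \<le> B"
    by auto
  have gap: "Gap f X (x k) > 0" and bt: "backtrack f X s \<gamma>u \<gamma>d (x k) (est k) (est (Suc k))"
    and next_x: "x (Suc k) = x k + step_size f X s (x k) (est (Suc k)) *\<^sub>R v_FW s (x k)"
    using run kT \<epsilon> unfolding LBTFWGSC_run_def by (auto intro: less_trans)
  note est = backtrack_estimate_bounds[OF IH(1) gap \<gamma> IH(2,3) B(3) bt]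
  show ?case
    using accepted_step_in_level_set[OF IH(1) gap est(1,3)] est next_x by simp
qed

text \<open>The free parameter \<open>\<beta>\<close> replaces the case distinction between full and short steps, and it is what
  allows the unknown gap to be replaced by the suboptimality.\<close>

lemma run_step:
  assumes run: "LBTFWGSC_run f X s \<gamma>u \<gamma>d \<epsilon> x est T" and "x 0 = x0"
    and \<gamma>: "\<gamma>u > 1" "\<gamma>d > 0" and \<epsilon>: "\<epsilon> > 0"
    and B: "0 < est 0" "est 0 \<le> B" "\<gamma>u * L_grad f X x0 \<le> B"
    and k: "enat k < T" and z: "z \<in> X \<inter> effdom f" and \<beta>: "0 \<le> \<beta>" "\<beta> \<le> 1"
  shows "rval f (x (Suc k)) - rval f z
    \<le> (1 - \<beta>) * (rval f (x k) - rval f z) + \<beta>^2 / 2 * (B * (diameter X)^2)"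
proof -
  have inv: "x k \<in> level_set f X x0" "0 < est k" "est k \<le> B"
    using run_invariant[OF run \<open>x 0 = x0\<close> \<gamma> \<epsilon> B] k by (auto simp: less_imp_le)
  have gap: "Gap f X (x k) > 0" and bt: "backtrack f X s \<gamma>u \<gamma>d (x k) (est k) (est (Suc k))"
    and next_x: "x (Suc k) = x k + step_size f X s (x k) (est (Suc k)) *\<^sub>R v_FW s (x k)"
    using run k \<epsilon> unfolding LBTFWGSC_run_def by (auto intro: less_trans)
  note est = backtrack_estimate_bounds[OF inv(1) gap \<gamma> inv(2,3) B(3) bt]
  have xX: "x k \<in> X \<inter> effdom f"
    using inv(1) mem_level_set by blast
  have "rval f (x (Suc k)) \<le> rval f (x k) - \<beta> * Gap f X (x k)
      + \<beta>^2 * (est (Suc k) * (norm (v_FW s (x k)))^2) / 2"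
    using accepted_step_descent[OF xX gap est(1,3) \<beta>] next_x by simp
  moreover have "\<beta> * (rval f (x k) - rval f z) \<le> \<beta> * Gap f X (x k)"
    using suboptimality_le_Gap[OF xX z] \<beta>(1) by (rule mult_left_mono)
  moreover have "\<beta>^2 * (est (Suc k) * (norm (v_FW s (x k)))^2) \<le> \<beta>^2 * (B * (diameter X)^2)"
    using est norm_v_FW_le_diameter[OF xX] by (intro mult_left_mono mult_mono power_mono) auto
  ultimately show ?thesis
    by (simp add: left_diff_distrib)
qed

end

section \<open>The iteration bound\<close>

theorem theorem4p10:
  fixes f :: "real^'n \<Rightarrow> ereal" and X :: "(real^'n) set" and s :: "real^'n \<Rightarrow> real^'n"
    and x :: "nat \<Rightarrow> real^'n" and xstar :: "real^'n" and est :: "nat \<Rightarrow> real" and T :: enat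
    and M \<nu> \<gamma>u \<gamma>d \<epsilon> fstar h0 Lbar :: real
  assumes "\<nu> \<in> {2..3}" and "M \<ge> 0" and "gsc M \<nu> f"
    and "convex X" and "compact X"
    and "xstar \<in> X" and "\<And>y. y \<in> X \<Longrightarrow> f xstar \<le> f y" and "fstar = rval f xstar"
    and "continuous_on (X \<inter> effdom f) (hess f)"
    and "\<And>y. y \<in> X \<inter> effdom f \<Longrightarrow> pos_def (hess f y)"
    and "lmo f X s"
    and "x 0 \<in> X \<inter> effdom f" and "est 0 > 0"
    and "\<gamma>u > 1" and "0 < \<gamma>d" and "\<gamma>d < 1" and "\<epsilon> > 0"
    and "LBTFWGSC_run f X s \<gamma>u \<gamma>d \<epsilon> x est T"
    and "h0 = rval f (x 0) - fstar"
    and "Lbar = max (\<gamma>u * L_grad f X (x 0)) (est 0)"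
  shows "ereal_of_enat (N_eps f fstar \<epsilon> x T)
    \<le> ereal (max 0 (ln (Lbar * (diameter X)^2 / h0) / ln (1/2) + 2 * Lbar * (diameter X)^2 / \<epsilon>))"
proof -
  interpret frank_wolfe_problem f X s "x 0" M \<nu>
    using assms by unfold_locales (auto simp: pos_def_def)
  define h where "h k = rval f (x k) - fstar" for k
  define C where "C = Lbar * (diameter X)^2"
  define good where "good k \<longleftrightarrow> enat k \<le> T \<and> h k \<le> \<epsilon>" for k
  define b where "b = ln (C / h 0) / ln (1/2) + 2 * C / \<epsilon>"
  have xstar: "xstar \<in> X \<inter> effdom f"
    using assms(6) assms(7)[of "x 0"] assms(12) by (auto simp: effdom_def intro: le_less_trans)
  have B: "est 0 \<le> Lbar" "\<gamma>u * L_grad f X (x 0) \<le> Lbar"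
    using assms(20) by auto
  note inv = run_invariant[OF assms(18) refl assms(14,15,17,13) B]
    and step = run_step[OF assms(18) refl assms(14,15,17,13) B _ xstar]
  have gap: "Gap f X (x k) > \<epsilon>" if "enat k < T" for k
    using assms(18) that by (simp add: LBTFWGSC_run_def)
  \<comment> \<open>The gap dominates the suboptimality, so the method cannot stop before accuracy \<open>\<epsilon>\<close>.\<close>
  have running: "enat k < T \<and> h k > \<epsilon>" if k: "enat k \<le> T" "\<not> good k" for k
  proof
    show hk: "h k > \<epsilon>"
      using k by (simp add: good_def)
    have "x k \<in> X \<inter> effdom f"
      using inv[OF k(1)] mem_level_set by blast
    from suboptimality_le_Gap[OF this xstar] hk have "Gap f X (x k) > \<epsilon>"
      by (simp add: h_def assms(8))
    then have "T \<noteq> enat k"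
      using assms(18) by (auto simp: LBTFWGSC_run_def)
    with k(1) show "enat k < T"
      by simp
  qed
  \<comment> \<open>Bounding every initial stretch of inaccurate iterates, and not only the one ending at the first
    accurate iterate, also shows that an accurate iterate exists.\<close>
  have count: "real n \<le> b" if n: "n > 0" and bad: "\<And>k. k < n \<Longrightarrow> \<not> good k" for n
  proof -
    have run: "enat k < T \<and> h k > \<epsilon>" if "k < n" for k
      using that
    proof (induction k)
      case 0
      then show ?case using running[of 0] bad by (simp add: zero_enat_def[symmetric])
    next
      case (Suc k)
      then show ?case using running[of "Suc k"] bad by (simp add: Suc_ile_eq)
    qed
    have x0: "x 0 \<in> X \<inter> effdom f"
      by (rule assms(12))
    have "Gap f X (x 0) > 0"
      using gap[of 0] run[of 0] n assms(17) by simp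
    then have "diameter X > 0"
      using norm_v_FW_pos[OF x0] norm_v_FW_le_diameter[OF x0] by linarith
    then have "C > 0"
      using B(1) assms(13) by (simp add: C_def)
    then show ?thesis
      unfolding b_def
    proof (rule frank_wolfe_recursion_count[OF _ assms(17) n])
      show "h k > \<epsilon>" if "k < n" for k
        using run[OF that] by simp
      show "h (Suc k) \<le> (1 - \<beta>) * h k + \<beta>^2 / 2 * C"
        if "Suc k < n" "0 \<le> \<beta>" "\<beta> \<le> 1" for k \<beta>
        using step[of k \<beta>] run[of k] that by (simp add: h_def C_def assms(8))
    qed
  qed
  have "\<exists>k. good k"
  proof (rule ccontr)
    assume "\<not> (\<exists>k. good k)"
    then have "real (Suc n) \<le> b" for n
      by (intro count) auto
    moreover obtain n where "b < real n"
      using reals_Archimedean2 by blast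
    ultimately show False
      by (metis less_le_not_le of_nat_Suc order_trans lessI less_imp_le of_nat_less_iff)
  qed
  define n where "n = (LEAST k. good k)"
  have "good n" and bad: "\<And>k. k < n \<Longrightarrow> \<not> good k"
    unfolding n_def using \<open>\<exists>k. good k\<close> by (auto intro: LeastI dest: not_less_Least)
  then have "N_eps f fstar \<epsilon> x T \<le> enat n"
    unfolding N_eps_def by (intro Inf_lower) (auto simp: good_def h_def)
  then have "ereal_of_enat (N_eps f fstar \<epsilon> x T) \<le> ereal (real n)"
    by (metis ereal_of_enat_le_iff ereal_of_enat_simps(1))
  also have "\<dots> \<le> ereal (max 0 b)"
    using count[of n] bad by (cases "n = 0") auto
  also have "b = ln (Lbar * (diameter X)^2 / h0) / ln (1/2) + 2 * Lbar * (diameter X)^2 / \<epsilon>"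
    by (simp add: b_def C_def h_def assms(19) mult.assoc)
  finally show ?thesis .
qed

end
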